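(* Let $p$ be a prime number, and let $q>2p^2$ be an integer relatively prime to $p$. Construct the $p-1$ modified CRT sequences $s_1(t),\ldots,s_{p-1}(t)$ of length $L=pq$ and assign them to users $1$ to $p-1$ (sequence $s_g$ to user $g$). Suppose that at most $(p+1)/2$ users are active at the same time. Then the activity-detection algorithm described in the context can successfully identify the active users and determine their starting time.
   Context: Modified CRT sequences: let $\gamma$ be the multiplicative inverse of $p$ in $\mathbb{Z}_q$ ($\gamma p\equiv1\bmod q$), let $\Phi'_{p,q}:\mathbb{Z}_{pq}\to\mathbb{Z}_p\oplus\mathbb{Z}_q$ be $\Phi'_{p,q}(x)=(x\bmod p,\ \gamma x\bmod q)$, and for $g\in\mathbb{Z}_p$ let $\mathcal{I}_g=\{(gt\bmod p,\ t):0\le t<q\}$. For $g=1,\ldots,p-1$, $s_g(t)=1$ if $\Phi'_{p,q}(t)\in\mathcal{I}_g$ and $s_g(t)=0$ otherwise, for $t=0,\ldots,L-1$, where $L=pq$. User model (partial user activity, collision channel without feedback): time is slotted and there are $p-1$ potential users. When a user changes from inactive to active, it sends packets according to its assigned protocol sequence, repeated periodically: if user $g$ becomes active at slot $t_0$ (its starting time), then while active it sends a packet in slot $t_0+t$ if and only if $s_g(t\bmod L)=1$. A user that becomes active remains active for at least one period of its sequence; after all its data are sent, it must remain inactive for at least $L$ slots before becoming active again. Inactive users do not transmit. Channel-activity signal: $c(t)=0$ if no user transmits in slot $t$, $c(t)=1$ if exactly one user transmits, and $c(t)=*$ if two or more users transmit. The signal $c$ is matched to $s_i$ at time $t_0$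 if for all $t=0,1,\ldots,L-1$: $s_i(t)=1$ implies $c(t_0+t)=1$ or $*$. Algorithm: the receiver observes only $c(t)$ and keeps track of the active users by Boolean variables $active(i)$ (FALSE meaning user $i$ is idle, TRUE meaning user $i$ is active) and variables $start(i)$ storing starting times, $i=1,\ldots,p-1$. To determine whether users become active or inactive at time $t_0$, it waits until $c(t_0),\ldots,c(t_0+L-1)$ are available and then, for each $i=1,\ldots,p-1$: if $active(i)$ is FALSE and $c$ is matched to $s_i$ at $t_0$, it sets $active(i)\leftarrow$ TRUE and $start(i)\leftarrow t_0$; if $active(i)$ is TRUE, $t_0-start(i)$ is a multiple of $L$, and $c$ is not matched to $s_i$ at $t_0$, it sets $active(i)\leftarrow$ FALSE and $start(i)\leftarrow 0$.
   Formalization: "Active at the same time" is read as: at most (p+1)/2 users are active somewhere in each window of L consecutive slots (the slot-by-slot claim is false); and in an incomplete last period of a session it is not claimed whether the user is listed as active. *)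

theory Defs
  imports Complex_Main "HOL-Number_Theory.Number_Theory"
begin

section \<open>Modified CRT sequences\<close>

definition crt_map :: "nat \<Rightarrow> nat \<Rightarrow> nat \<Rightarrow> nat \<times> nat" where
  "crt_map p q x = (x mod p, (THE \<gamma>. \<gamma> < q \<and> [\<gamma> * p = 1] (mod q)) * x mod q)"

definition crt_set :: "nat \<Rightarrow> nat \<Rightarrow> nat \<Rightarrow> (nat \<times> nat) set" where
  "crt_set p q g = {((g * t) mod p, t) | t. t < q}"

definition crt_seq :: "nat \<Rightarrow> nat \<Rightarrow> nat \<Rightarrow> nat \<Rightarrow> nat" where
  "crt_seq p q g t = (if crt_map p q t \<in> crt_set p q g then 1 else 0)"

definition users :: "nat \<Rightarrow> nat set" where
  "users p = {1..p - 1}"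


section \<open>User activity\<close>

text \<open>
  Slots are numbered from 0. An activity pattern \<open>act\<close> says in which slots each user is active;
  no user is active before slot 0, so a user that is active in slot 0 becomes active there.
  A user may stay active forever, and its sessions need not consist of whole periods.
\<close>

definition becomes_active :: "(nat \<Rightarrow> nat \<Rightarrow> bool) \<Rightarrow> nat \<Rightarrow> nat \<Rightarrow> bool" where
  "becomes_active act g s \<longleftrightarrow> act g s \<and> (s = 0 \<or> \<not> act g (s - 1))"

text \<open>User \<open>g\<close> became active at slot \<open>s\<close> and has not become inactive up to and including slot \<open>t\<close>.\<close>

definition active_since :: "(nat \<Rightarrow> nat \<Rightarrow> bool) \<Rightarrow> nat \<Rightarrow> nat \<Rightarrow> nat \<Rightarrow> bool" where
  "active_since act g s t \<longleftrightarrow> becomes_active act g s \<and> s \<le> t \<and> (\<forall>u\<in>{s..t}. act g u)"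

definition partial_activity :: "nat \<Rightarrow> nat set \<Rightarrow> (nat \<Rightarrow> nat \<Rightarrow> bool) \<Rightarrow> bool" where
  "partial_activity L U act \<longleftrightarrow>
     (\<forall>g\<in>U. \<forall>s. becomes_active act g s \<longrightarrow> (\<forall>u\<in>{s..<s + L}. act g u)) \<and>
     (\<forall>g\<in>U. \<forall>t. act g t \<and> \<not> act g (Suc t) \<longrightarrow> (\<forall>u\<in>{Suc t..<Suc t + L}. \<not> act g u))"

text \<open>Every activity session that ends consists of whole periods.\<close>

definition whole_periods :: "nat \<Rightarrow> (nat \<Rightarrow> nat \<Rightarrow> bool) \<Rightarrow> nat \<Rightarrow> bool" where
  "whole_periods L act g \<longleftrightarrow>
     (\<forall>s t. active_since act g s t \<and> \<not> act g (Suc t) \<longrightarrow> L dvd Suc t - s)"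


section \<open>Collision channel\<close>

definition transmits :: "nat \<Rightarrow> nat \<Rightarrow> (nat \<Rightarrow> nat \<Rightarrow> bool) \<Rightarrow> nat \<Rightarrow> nat \<Rightarrow> bool" where
  "transmits p q act g t \<longleftrightarrow>
     (\<exists>s. active_since act g s t \<and> crt_seq p q g ((t - s) mod (p * q)) = 1)"

datatype channel = Idle | Single | Collision

definition channel_activity :: "nat \<Rightarrow> nat \<Rightarrow> (nat \<Rightarrow> nat \<Rightarrow> bool) \<Rightarrow> nat \<Rightarrow> channel" where
  "channel_activity p q act t =
     (let n = card {g \<in> users p. transmits p q act g t}
      in if n = 0 then Idle else if n = 1 then Single else Collision)"


section \<open>Activity detection\<close>

definition matched :: "nat \<Rightarrow> nat \<Rightarrow> (nat \<Rightarrow> channel) \<Rightarrow> nat \<Rightarrow> nat \<Rightarrow> bool" where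
  "matched p q c i t0 \<longleftrightarrow>
     (\<forall>t<p * q. crt_seq p q i t = 1 \<longrightarrow> c (t0 + t) = Single \<or> c (t0 + t) = Collision)"

record receiver =
  active :: "nat \<Rightarrow> bool"
  start :: "nat \<Rightarrow> nat"

definition initial_receiver :: receiver where
  "initial_receiver = \<lparr>active = (\<lambda>_. False), start = (\<lambda>_. 0)\<rparr>"

definition detects_start :: "nat \<Rightarrow> nat \<Rightarrow> (nat \<Rightarrow> channel) \<Rightarrow> nat \<Rightarrow> receiver \<Rightarrow> nat \<Rightarrow> bool" where
  "detects_start p q c t0 R i \<longleftrightarrow> i \<in> users p \<and> \<not> active R i \<and> matched p q c i t0"

definition detects_end :: "nat \<Rightarrow> nat \<Rightarrow> (nat \<Rightarrow> channel) \<Rightarrow> nat \<Rightarrow> receiver \<Rightarrow> nat \<Rightarrow> bool" where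
  "detects_end p q c t0 R i \<longleftrightarrow>
     i \<in> users p \<and> active R i \<and> [t0 = start R i] (mod p * q) \<and> \<not> matched p q c i t0"

definition receiver_step :: "nat \<Rightarrow> nat \<Rightarrow> (nat \<Rightarrow> channel) \<Rightarrow> nat \<Rightarrow> receiver \<Rightarrow> receiver" where
  "receiver_step p q c t0 R =
     \<lparr>active = (\<lambda>i. if detects_start p q c t0 R i then True
                    else if detects_end p q c t0 R i then False else active R i),
      start = (\<lambda>i. if detects_start p q c t0 R i then t0
                   else if detects_end p q c t0 R i then 0 else start R i)\<rparr>"

text \<open>
  The receiver variables before the decision for slot \<open>n\<close>, that is, after the decisions for the
  slots \<open>0, \<dots>, n - 1\<close>. The decision for slot \<open>n\<close> looks at the channel only in the slots
  \<open>n, \<dots>, n + p q - 1\<close>.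
\<close>

primrec receiver_state :: "nat \<Rightarrow> nat \<Rightarrow> (nat \<Rightarrow> channel) \<Rightarrow> nat \<Rightarrow> receiver" where
  "receiver_state p q c 0 = initial_receiver"
| "receiver_state p q c (Suc n) = receiver_step p q c n (receiver_state p q c n)"


section \<open>Successful identification\<close>

text \<open>
  Slot \<open>t\<close> lies in the period \<open>{period_first L s t..period_last L s t}\<close> of a sequence of
  period \<open>L\<close> that is started at \<open>s \<le> t\<close>.
\<close>

definition period_first :: "nat \<Rightarrow> nat \<Rightarrow> nat \<Rightarrow> nat" where
  "period_first L s t = s + (t - s) div L * L"

definition period_last :: "nat \<Rightarrow> nat \<Rightarrow> nat \<Rightarrow> nat" where
  "period_last L s t = period_first L s t + (L - 1)"

text \<open>
  The receiver tests an active user only once per period, so if a session is cut off in the middle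
  of a period, the end is known only up to that incomplete last period: whether the receiver lists
  the user as active during it depends on where the cut lies. Everything else is exact:
  an activation is declared exactly when a user becomes active; a user in a complete period is
  listed as active with its true starting time; a listed user really started at the stored time, and has
  remained active at least into the current period; and for a user that always sends whole periods,
  the listing is exact in every slot.
\<close>

definition identifies_user ::
  "nat \<Rightarrow> (nat \<Rightarrow> nat \<Rightarrow> bool) \<Rightarrow> (nat \<Rightarrow> receiver) \<Rightarrow> nat \<Rightarrow> nat \<Rightarrow> bool" where
  "identifies_user L act R g t \<longleftrightarrow>
     (becomes_active act g t \<longleftrightarrow> \<not> active (R t) g \<and> active (R (Suc t)) g) \<and>
     (\<forall>s\<le>t. active_since act g s (period_last L s t) \<longrightarrow>
        active (R (Suc t)) g \<and> start (R (Suc t)) g = s) \<and>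
     (active (R (Suc t)) g \<longrightarrow> start (R (Suc t)) g \<le> t \<and>
        active_since act g (start (R (Suc t)) g) (period_first L (start (R (Suc t)) g) t)) \<and>
     (whole_periods L act g \<longrightarrow>
        (active (R (Suc t)) g \<longleftrightarrow> act g t) \<and>
        (act g t \<longrightarrow> active_since act g (start (R (Suc t)) g) t))"

end

theory Submission
  imports Defs
begin

text \<open>
  Number the ones in a period of \<open>s_g\<close> by \<open>x = 0, \<dots>, q - 1\<close>, as in the set \<open>I_g\<close>. A session of another user
  hits the ones of \<open>s_g\<close> only at those \<open>x\<close> that lie in one residue class modulo \<open>p\<close> below some threshold
  and in one residue class above it. If user \<open>g\<close> is idle during the whole window, then some block of
  \<open>p\<close> consecutive \<open>x\<close> contains no threshold of the at most \<open>(p + 1) / 2 < p\<close> active users, so some one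
  of \<open>s_g\<close> in that block is not hit. If user \<open>g\<close> itself is active in the window, there are at most
  \<open>(p - 1) / 2\<close> others, and they hit at most \<open>p - 1\<close> residue classes; so it suffices that the ones missed by
  the session of \<open>g\<close> represent all residue classes modulo \<open>p\<close>. For a session shifted by less than \<open>p\<^sup>2\<close>
  they contain \<open>p\<close> consecutive \<open>x\<close>; for a larger shift, the ones among the first (or last) \<open>p\<^sup>2\<close> slots of
  the period already do. Hence the channel is matched only at period boundaries of a session of
  \<open>g\<close> or inside a complete period, where the receiver already
  lists \<open>g\<close> as active and does not test.
\<close>

section \<open>Ones of the modified CRT sequences\<close>

locale crt_parameters =
  fixes p q :: nat
  assumes prime_p: "prime p" and q_gt: "q > 2 * p\<^sup>2" and coprime_pq: "coprime p q"
begin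

text \<open>
  The \<open>x\<close>-th one of \<open>s_g\<close> lies at the time \<open>t\<close> with \<open>\<Phi>'(t) = (g x mod p, x)\<close>; multiplying the second
  coordinate by \<open>p\<close> removes the inverse \<open>\<gamma>\<close>.
\<close>

definition hits :: "nat \<Rightarrow> int \<Rightarrow> int \<Rightarrow> bool" where
  "hits g t x \<longleftrightarrow> 0 \<le> x \<and> x < int q \<and> [int p * x = t] (mod int q) \<and> [int g * x = t] (mod int p)"

lemma p_ge_2: "p \<ge> 2"
  using prime_p by (rule prime_ge_2_nat)

lemma q_gt_int: "int q > 2 * (int p * int p)"
  using q_gt by (metis of_nat_less_iff of_nat_mult of_nat_numeral power2_eq_square)

lemma p_le_square: "int p \<le> int p * int p"
  using p_ge_2 by (simp add: mult_le_cancel_left1)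

lemma not_dvd_q: "\<not> int p dvd int q"
  using coprime_pq prime_p p_ge_2
  by (metis coprime_def dvd_refl int_dvd_int_iff not_prime_unit)

lemma prime_int_p: "prime (int p)"
  using prime_p by simp

lemma coprime_user: "g \<in> users p \<Longrightarrow> \<not> int p dvd int g"
  by (auto simp: users_def dest: dvd_imp_le)

lemma crt_seq_eq_1_iff: "crt_seq p q g t = 1 \<longleftrightarrow> (\<exists>x. hits g (int t) x)"
proof -
  have q1: "q > 1" using q_gt_int p_le_square p_ge_2 by linarith
  obtain y where y: "[p * y = 1] (mod q)"
    using coprime_pq cong_solve_coprime_nat[of p q] by auto
  define c where "c = (THE c. c < q \<and> [c * p = 1] (mod q))"
  have "c < q \<and> [c * p = 1] (mod q)"
    unfolding c_def
  proof (rule theI[where a = "y mod q"])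
    show "y mod q < q \<and> [y mod q * p = 1] (mod q)"
      using y q1 by (simp add: cong_def mod_simps mult.commute)
  next
    fix z assume "z < q \<and> [z * p = 1] (mod q)"
    then have "[z * p = y * p] (mod q)" and "z < q"
      using y by (auto simp: cong_def mult.commute)
    then have "[z = y] (mod q)"
      using coprime_pq by (simp add: cong_mult_rcancel_nat coprime_commute)
    then show "z = y mod q" using \<open>z < q\<close> by (simp add: cong_def)
  qed
  then have cq: "c < q" and c1: "[c * p = 1] (mod q)" by auto
  have "crt_seq p q g t = 1 \<longleftrightarrow> (\<exists>x<q. t mod p = g * x mod p \<and> c * t mod q = x)"
    by (auto simp: crt_seq_def crt_map_def crt_set_def c_def)
  also have "\<dots> \<longleftrightarrow> (\<exists>x<q. [p * x = t] (mod q) \<and> [g * x = t] (mod p))"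
  proof -
    have "c * t mod q = x \<longleftrightarrow> [p * x = t] (mod q)" if "x < q" for x
    proof
      assume "c * t mod q = x"
      then have "[c * t = x] (mod q)" using that by (simp add: cong_def)
      then have "[p * x = (c * p) * t] (mod q)"
        using cong_scalar_left[OF cong_sym, of "c * t" x q p] by (simp add: ac_simps)
      also have "[(c * p) * t = 1 * t] (mod q)"
        using c1 by (rule cong_scalar_right)
      finally show "[p * x = t] (mod q)" by simp
    next
      assume "[p * x = t] (mod q)"
      then have "[(c * p) * x = c * t] (mod q)"
        using cong_scalar_left[of "p * x" t q c] by (simp add: ac_simps)
      moreover have "[(c * p) * x = 1 * x] (mod q)"
        using c1 by (rule cong_scalar_right)
      ultimately have "[c * t = x] (mod q)" 
        using cong_trans[OF cong_sym] by simp
      then show "c * t mod q = x" using that by (simp add: cong_def)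
    qed
    moreover have "t mod p = g * x mod p \<longleftrightarrow> [g * x = t] (mod p)" for x
      by (auto simp: cong_def)
    ultimately show ?thesis by blast
  qed
  also have "\<dots> \<longleftrightarrow> (\<exists>x. hits g (int t) x)"
  proof
    assume "\<exists>x<q. [p * x = t] (mod q) \<and> [g * x = t] (mod p)"
    then obtain x where "x < q" "[p * x = t] (mod q)" "[g * x = t] (mod p)" by blast
    then have "hits g (int t) (int x)"
      unfolding hits_def by (simp flip: of_nat_mult cong_int_iff)
    then show "\<exists>x. hits g (int t) x" ..
  next
    assume "\<exists>x. hits g (int t) x"
    then obtain x where x: "hits g (int t) x" ..
    then obtain n where "x = int n" unfolding hits_def using nonneg_int_cases by blast
    with x show "\<exists>x<q. [p * x = t] (mod q) \<and> [g * x = t] (mod p)"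
      unfolding hits_def by (auto simp flip: of_nat_mult simp: cong_int_iff)
  qed
  finally show ?thesis .
qed

lemma hits_exists:
  assumes "0 \<le> x" "x < int q"
  shows "\<exists>t<p * q. hits g (int t) x"
proof -
  obtain n where n: "x = int n" using assms nonneg_int_cases by blast
  obtain t where t: "[t = p * n] (mod q)" "[t = g * n] (mod p)"
    using binary_chinese_remainder_nat[of q p "p * n" "g * n"] coprime_pq
    by (auto simp: coprime_commute)
  have "[t mod (p * q) = p * n] (mod q)" "[t mod (p * q) = g * n] (mod p)"
    using t by (auto simp: cong_def mod_mod_cancel)
  then have "[p * n = t mod (p * q)] (mod q)" "[g * n = t mod (p * q)] (mod p)"
    by (auto intro: cong_sym)
  then have "hits g (int (t mod (p * q))) x"
    using assms n unfolding hits_def by (metis cong_int_iff of_nat_mult)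
  moreover have "t mod (p * q) < p * q"
    using p_ge_2 q_gt by (intro mod_less_divisor) auto
  ultimately show ?thesis by blast
qed

lemma hits_unique:
  assumes "hits g t x" "hits g u x" "0 \<le> t" "t < int (p * q)" "0 \<le> u" "u < int (p * q)"
  shows "t = u"
proof -
  have "[t = u] (mod int q)" "[t = u] (mod int p)"
    using assms(1,2) cong_trans[OF cong_sym] unfolding hits_def by blast+
  then have "[t = u] (mod int p * int q)"
    using coprime_pq by (intro coprime_cong_mult) auto
  then show ?thesis using assms by (simp add: cong_less_imp_eq_int)
qed

lemma hits_shift:
  assumes "hits g t x" "hits h (t + d) y"
  shows "[int p * (y - x) = d] (mod int q)" "[int h * y - int g * x = d] (mod int p)"
  using assms cong_diff[of "int p * y" "t + d" "int q" "int p * x" t]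
    cong_diff[of "int h * y" "t + d" "int p" "int g * x" t]
  unfolding hits_def by (simp_all add: right_diff_distrib)

lemma hits_diff:
  assumes "hits g t x" "hits h (t + d) y" "hits g t' x'" "hits h (t' + d) y'"
  shows "[y - x = y' - x'] (mod int q)"
    and "[int h * y - int g * x = int h * y' - int g * x'] (mod int p)"
proof -
  have "[int p * (y - x) = int p * (y' - x')] (mod int q)"
    using hits_shift(1)[OF assms(1,2)] hits_shift(1)[OF assms(3,4)] by (simp add: cong_def)
  then show "[y - x = y' - x'] (mod int q)"
    using coprime_pq by (simp add: cong_mult_lcancel)
  show "[int h * y - int g * x = int h * y' - int g * x'] (mod int p)"
    using hits_shift(2)[OF assms(1,2)] hits_shift(2)[OF assms(3,4)] by (simp add: cong_def)
qed

definition two_class :: "int set \<Rightarrow> bool" where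
  "two_class C \<longleftrightarrow> (\<exists>b. \<forall>x\<in>C. \<forall>y\<in>C. (x < b \<longleftrightarrow> y < b) \<longrightarrow> [x = y] (mod int p))"

lemma cong_cases:
  fixes a b m :: int
  assumes "[a = b] (mod m)" "\<bar>a - b\<bar> < 2 * m"
  shows "a = b \<or> a = b + m \<or> a = b - m"
proof -
  obtain k where k: "a - b = m * k" using assms(1) by (auto simp: cong_iff_dvd_diff)
  have "m > 0" using assms(2) by linarith
  with k assms(2) have "m * \<bar>k\<bar> < m * 2" by (simp add: abs_mult)
  then have "\<bar>k\<bar> < 2" using \<open>m > 0\<close> by simp
  then have "k = 0 \<or> k = 1 \<or> k = -1" by linarith
  then show ?thesis using k by auto
qed

lemma cross_two_class:
  assumes "g \<in> users p" "h \<in> users p" "g \<noteq> h"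
  shows "two_class {x. \<exists>t. hits g t x \<and> (\<exists>y. hits h (t + d) y)}"
proof -
  obtain z where z: "[int p * z = 1] (mod int q)"
    using coprime_pq cong_solve_coprime_int[of "int p" "int q"] by auto
  define b where "b = int q - (z * d) mod int q"
  have q0: "int q > 0" using q_gt by simp
  have *: "y = (if x < b then x + (z * d) mod int q else x + (z * d) mod int q - int q)"
    if "hits g t x" "hits h (t + d) y" for t x y
  proof -
    have "[z * (int p * (y - x)) = z * d] (mod int q)"
      using hits_shift(1)[OF that] by (rule cong_scalar_left)
    moreover have "[(int p * z) * (y - x) = 1 * (y - x)] (mod int q)"
      using z by (rule cong_scalar_right)
    ultimately have "[y - x = z * d] (mod int q)"
      by (simp add: cong_def ac_simps)
    then have "[y - x = (z * d) mod int q] (mod int q)" by (simp add: cong_def)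
    moreover have "0 \<le> (z * d) mod int q" "(z * d) mod int q < int q"
      using q0 by auto
    ultimately show ?thesis
      using cong_cases[of "y - x" "(z * d) mod int q" "int q"] that
      unfolding hits_def b_def by (smt (verit, best))
  qed
  have "[x = x'] (mod int p)"
    if h: "hits g t x" "hits h (t + d) y" "hits g t' x'" "hits h (t' + d) y'"
      and xb: "x < b \<longleftrightarrow> x' < b" for t x y t' x' y'
  proof -
    have "y - x = y' - x'" using *[OF h(1,2)] *[OF h(3,4)] xb by auto
    then have y: "y = x + y' - x'" by simp
    have "int p dvd (int h * y - int g * x) - (int h * y' - int g * x')"
      using hits_diff(2)[OF h] by (simp add: cong_iff_dvd_diff)
    also have "\<dots> = (int h - int g) * (x - x')" unfolding y by (simp add: algebra_simps)
    finally have "int p dvd int h - int g \<or> int p dvd x - x'"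
      using prime_int_p by (simp add: prime_dvd_mult_iff)
    moreover have "\<not> int p dvd int h - int g"
    proof
      assume "int p dvd int h - int g"
      then have "[h = g] (mod p)" by (simp add: cong_iff_dvd_diff flip: cong_int_iff)
      moreover have "h < p" "g < p" using assms(1,2) by (auto simp: users_def)
      ultimately show False using assms(3) by (simp add: cong_def)
    qed
    ultimately show ?thesis by (simp add: cong_iff_dvd_diff)
  qed
  then show ?thesis unfolding two_class_def by (intro exI[of _ b]) blast
qed

lemma two_class_subset: "two_class D \<Longrightarrow> C \<subseteq> D \<Longrightarrow> two_class C"
  unfolding two_class_def by blast

lemma card_residues_le:
  assumes "two_class C"
  shows "finite ((\<lambda>x. x mod int p) ` C)" "card ((\<lambda>x. x mod int p) ` C) \<le> 2"
proof -
  obtain b where b: "\<forall>x\<in>C. \<forall>y\<in>C. (x < b \<longleftrightarrow> y < b) \<longrightarrow> [x = y] (mod int p)"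
    using assms unfolding two_class_def by blast
  have "\<exists>u v. (\<lambda>x. x mod int p) ` C \<subseteq> {u, v}"
  proof -
    define u where "u = (SOME x. x \<in> C \<and> x < b)"
    define v where "v = (SOME x. x \<in> C \<and> \<not> x < b)"
    have "x mod int p \<in> {u mod int p, v mod int p}" if "x \<in> C" for x
    proof (cases "x < b")
      case True
      then have "u \<in> C \<and> u < b" unfolding u_def using that by (metis (mono_tags, lifting) someI_ex)
      then have "[x = u] (mod int p)" using b that True by blast
      then show ?thesis by (simp add: cong_def)
    next
      case False
      then have "v \<in> C \<and> \<not> v < b" unfolding v_def using that by (metis (mono_tags, lifting) someI_ex)
      then have "[x = v] (mod int p)" using b that False by blast
      then show ?thesis by (simp add: cong_def)
    qed
    then show ?thesis by blast
  qed
  then obtain u v where uv: "(\<lambda>x. x mod int p) ` C \<subseteq> {u, v}" by blast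
  then show "finite ((\<lambda>x. x mod int p) ` C)" by (rule finite_subset) simp
  have "card ((\<lambda>x. x mod int p) ` C) \<le> card {u, v}" using uv by (intro card_mono) auto
  also have "\<dots> \<le> 2" by (simp add: card_insert_if)
  finally show "card ((\<lambda>x. x mod int p) ` C) \<le> 2" .
qed

lemma uncovered_in_complete_residues:
  assumes "finite J" "2 * card J < p" "\<And>j. j \<in> J \<Longrightarrow> two_class (C j)"
    and T: "\<And>r. \<exists>x\<in>T. [x = r] (mod int p)"
  shows "\<exists>x\<in>T. \<forall>j\<in>J. x \<notin> C j"
proof (rule ccontr)
  assume "\<not> ?thesis"
  then have cov: "\<And>x. x \<in> T \<Longrightarrow> \<exists>j\<in>J. x \<in> C j" by blast
  have "{0..<int p} \<subseteq> (\<Union>j\<in>J. (\<lambda>x. x mod int p) ` C j)"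
  proof
    fix r assume "r \<in> {0..<int p}"
    moreover obtain x where "x \<in> T" "[x = r] (mod int p)" using T by blast
    ultimately show "r \<in> (\<Union>j\<in>J. (\<lambda>x. x mod int p) ` C j)"
      using cov[of x] by (force simp: cong_def)
  qed
  then have "card {0..<int p} \<le> card (\<Union>j\<in>J. (\<lambda>x. x mod int p) ` C j)"
    using assms(1,3) card_residues_le(1) by (intro card_mono) auto
  also have "\<dots> \<le> (\<Sum>j\<in>J. card ((\<lambda>x. x mod int p) ` C j))"
    using assms(1) by (rule card_UN_le)
  also have "\<dots> \<le> (\<Sum>j\<in>J. 2)"
    using assms(3) card_residues_le(2) by (intro sum_mono) auto
  finally show False using assms(2) by simp
qed

text \<open>
  Each class boundary lies in at most one of the blocks \<open>{k p..<k p + p}\<close> with \<open>k < p\<close>, and a block without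
  boundaries meets each covered set at most once.
\<close>

lemma uncovered_below_square:
  assumes "finite J" "card J < p" "\<And>j. j \<in> J \<Longrightarrow> two_class (C j)"
  shows "\<exists>x. 0 \<le> x \<and> x < int q \<and> (\<forall>j\<in>J. x \<notin> C j)"
proof -
  obtain b where b: "\<And>j x y. j \<in> J \<Longrightarrow> x \<in> C j \<Longrightarrow> y \<in> C j \<Longrightarrow> (x < b j \<longleftrightarrow> y < b j)
      \<Longrightarrow> [x = y] (mod int p)"
    using assms(3) unfolding two_class_def by metis
  have "card ((\<lambda>j. b j div int p) ` J) < card {0..<int p}"
    using card_image_le[OF assms(1), of "\<lambda>j. b j div int p"] assms(2) by simp
  then have "\<not> {0..<int p} \<subseteq> (\<lambda>j. b j div int p) ` J"
    using card_mono[of "(\<lambda>j. b j div int p) ` J"] assms(1) by (meson finite_imageI leD)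
  then obtain k where "k \<in> {0..<int p}" "k \<notin> (\<lambda>j. b j div int p) ` J" by blast
  then have k: "0 \<le> k" "k < int p" "\<And>j. j \<in> J \<Longrightarrow> b j div int p \<noteq> k" by auto
  let ?B = "{int p * k..<int p * k + int p}"
  have side: "x < b j \<longleftrightarrow> y < b j" if "j \<in> J" "x \<in> ?B" "y \<in> ?B" for j x y
  proof -
    have "b j = int p * (b j div int p) + b j mod int p" by simp
    moreover have "0 \<le> b j mod int p" "b j mod int p < int p" using p_ge_2 by auto
    moreover have "int p * (b j div int p) \<ge> int p * k + int p
        \<or> int p * (b j div int p) + int p \<le> int p * k"
    proof -
      have "b j div int p \<ge> k + 1 \<or> b j div int p + 1 \<le> k" using k(3)[OF that(1)] by linarith
      then have "int p * (b j div int p) \<ge> int p * (k + 1)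
        \<or> int p * (b j div int p + 1) \<le> int p * k" using p_ge_2 by (auto intro: mult_left_mono)
      then show ?thesis by (simp add: distrib_left)
    qed
    ultimately show ?thesis using that(2,3) unfolding atLeastLessThan_iff by linarith
  qed
  have one: "card (C j \<inter> ?B) \<le> 1" if j: "j \<in> J" for j
  proof -
    have "x = y" if "x \<in> C j \<inter> ?B" "y \<in> C j \<inter> ?B" for x y
    proof -
      have "[x = y] (mod int p)" using b[OF j] side[OF j] that by blast
      then have "[x - int p * k = y - int p * k] (mod int p)" by (rule cong_diff) simp
      then show ?thesis using cong_less_imp_eq_int[of "x - int p * k" "int p" "y - int p * k"] that
        by auto
    qed
    then show ?thesis by (metis card_le_Suc0_iff_eq One_nat_def finite_Int finite_atLeastLessThan_int)
  qed
  have "card (\<Union>j\<in>J. C j \<inter> ?B) \<le> (\<Sum>j\<in>J. card (C j \<inter> ?B))" using assms(1) by (rule card_UN_le)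
  also have "\<dots> \<le> (\<Sum>j\<in>J. 1)" using one by (intro sum_mono) auto
  also have "\<dots> < card ?B" using assms(2) by simp
  finally have "\<not> ?B \<subseteq> (\<Union>j\<in>J. C j \<inter> ?B)"
    using card_mono[of "\<Union>j\<in>J. C j \<inter> ?B" ?B] assms(1) by (meson finite_Int finite_UN_I finite_atLeastLessThan_int leD)
  then obtain x where x: "x \<in> ?B" "\<forall>j\<in>J. x \<notin> C j" by blast
  have "int p * (k + 1) \<le> int p * int p" using k by (intro mult_left_mono) auto
  then have "x < int q" using x(1) q_gt_int by (auto simp: distrib_left)
  moreover have "0 \<le> x" using x(1) k(1) by (smt (verit) atLeastLessThan_iff mult_nonneg_nonneg of_nat_0_le_iff)
  ultimately show ?thesis using x(2) by blast
qed

text \<open>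
  A user shifted by \<open>d\<close> sends \<open>x\<close> onto \<open>y\<close> with \<open>p (y - x) \<equiv> d\<close> modulo \<open>q\<close>, which forces \<open>\<bar>y - x\<bar> \<ge> p\<close>; the
  congruence modulo \<open>p\<close> excludes that both signs of \<open>y - x\<close> occur. So the shift misses the first or
  the last \<open>p\<close> values of \<open>x\<close>.
\<close>

lemma small_shift:
  assumes g: "g \<in> users p" and d: "d \<noteq> 0" "\<bar>d\<bar> < int p * int p"
  shows "\<exists>x. 0 \<le> x \<and> x < int q \<and> [x = r] (mod int p) \<and> (\<forall>t y. hits g t x \<longrightarrow> \<not> hits g (t + d) y)"
proof (rule ccontr)
  assume no: "\<not> ?thesis"
  have far: "\<bar>y - x\<bar> \<ge> int p" if h: "hits g t x" "hits g (t + d) y" for t x y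
  proof (rule ccontr)
    assume "\<not> ?thesis"
    then have "int p * \<bar>y - x\<bar> \<le> int p * int p" by (intro mult_left_mono) auto
    then have "\<bar>int p * (y - x)\<bar> \<le> int p * int p" by (simp add: abs_mult)
    then have "\<bar>int p * (y - x) - d\<bar> < int q" using d(2) q_gt_int by linarith
    moreover have "int q dvd int p * (y - x) - d"
      using hits_shift(1)[OF h] by (simp add: cong_iff_dvd_diff)
    ultimately have pd: "int p * (y - x) = d"
      using dvd_imp_le_int[of "int p * (y - x) - d" "int q"] by auto
    have "int p dvd int g * (y - x) - int p * (y - x)"
      using hits_shift(2)[OF h] pd by (simp add: cong_iff_dvd_diff algebra_simps)
    then have "int p dvd int g * (y - x)"
      by (metis diff_add_cancel dvd_add dvd_triv_left)
    then have "int p dvd y - x"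
      using coprime_user[OF g] prime_int_p by (simp add: prime_dvd_mult_iff)
    then have "y - x = 0" using \<open>\<not> \<bar>y - x\<bar> \<ge> int p\<close> dvd_imp_le_int[of "y - x" "int p"] by auto
    then show False using pd d by simp
  qed
  have p0: "int p > 0" and pq: "2 * int p < int q" using p_ge_2 q_gt_int p_le_square by linarith+
  define x where "x = r mod int p"
  have x: "0 \<le> x" "x < int p" "[x = r] (mod int p)" unfolding x_def using p0 by auto
  obtain t y where h: "hits g t x" "hits g (t + d) y" using no x pq p0 by (smt (verit))
  define x' where "x' = int q - int p + (r - int q) mod int p"
  have "0 \<le> (r - int q) mod int p" "(r - int q) mod int p < int p" using p0 by auto
  then have x': "int q - int p \<le> x'" "x' < int q" unfolding x'_def by auto
  have "[x' = r] (mod int p)" unfolding x'_def cong_def by (simp add: mod_simps)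
  then obtain t' y' where h': "hits g t' x'" "hits g (t' + d) y'"
    using no x' pq p0 by (smt (verit))
  have "y - x \<ge> int p" using far[OF h] x h(2) unfolding hits_def by linarith
  moreover have "y' - x' \<le> - int p" using far[OF h'] x' h'(2) unfolding hits_def by linarith
  moreover have "\<bar>(y - x) - (y' - x')\<bar> < 2 * int q" 
    using h h' unfolding hits_def by linarith
  ultimately have e: "y - x = y' - x' + int q"
    using cong_cases[OF hits_diff(1)[OF h h']] p0 q_gt_int by linarith
  have "int p dvd (int g * y - int g * x) - (int g * y' - int g * x')"
    using hits_diff(2)[OF h h'] by (simp add: cong_iff_dvd_diff)
  also have "\<dots> = int g * ((y - x) - (y' - x'))" by (simp add: algebra_simps)
  also have "\<dots> = int g * int q" using e by simp
  finally show False
    using coprime_user[OF g] not_dvd_q prime_int_p by (simp add: prime_dvd_mult_iff)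
qed

text \<open>
  Write \<open>p x = t + q w\<close>. Then \<open>w\<close> modulo \<open>p\<close> is determined by the residue \<open>r\<close> of \<open>x\<close> modulo \<open>p\<close>, and
  so is \<open>t\<close> modulo \<open>p\<^sup>2\<close>.
\<close>

lemma residues_in_square_window:
  "\<exists>w t. c \<le> w \<and> w < c + int p \<and> a \<le> t \<and> t < a + int p * int p \<and>
    (\<exists>x. int p * x = t + int q * w \<and> [x = r] (mod int p)) \<and> [int g * r = t] (mod int p)"
proof -
  have p0: "int p > 0" using p_ge_2 by simp
  obtain v where v: "[int q * v = 1] (mod int p)"
    using coprime_pq cong_solve_coprime_int[of "int q" "int p"] by (auto simp: coprime_commute)
  define w where "w = c + (v * (- int g * r) - c) mod int p"
  have w: "c \<le> w" "w < c + int p" unfolding w_def using p0 by auto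
  have "[w = v * (- int g * r)] (mod int p)" unfolding w_def cong_def by (simp add: mod_simps)
  then have "[int q * w = int q * (v * (- int g * r))] (mod int p)" by (rule cong_scalar_left)
  also have "[int q * (v * (- int g * r)) = 1 * (- int g * r)] (mod int p)"
    using cong_scalar_right[OF v, of "- int g * r"] by (simp add: mult.assoc)
  finally have qw: "[int q * w = - int g * r] (mod int p)" by simp
  define t where "t = a + (int p * r - int q * w - a) mod (int p * int p)"
  have t: "a \<le> t" "t < a + int p * int p" unfolding t_def using p0 by auto
  have "[t = int p * r - int q * w] (mod int p * int p)" unfolding t_def cong_def by (simp add: mod_simps)
  then obtain m where m: "t - (int p * r - int q * w) = int p * int p * m"
    by (auto simp: cong_iff_dvd_diff)
  then have x: "int p * (r + int p * m) = t + int q * w" by (simp add: algebra_simps)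
  have tt: "t = int p * (r + int p * m) - int q * w" using x by simp
  have "int p dvd int q * w + int g * r" using qw by (simp add: cong_iff_dvd_diff)
  then have "int p dvd (int q * w + int g * r) - int p * (r + int p * m)" by (intro dvd_diff) auto
  then have "[int g * r = t] (mod int p)" unfolding cong_iff_dvd_diff tt by (simp add: algebra_simps)
  moreover have "[r + int p * m = r] (mod int p)" by (simp add: cong_def)
  ultimately show ?thesis using w t x by blast
qed

lemma hits_square_window:
  assumes "int p * x = t + int q * w" "[x = r] (mod int p)" "[int g * r = t] (mod int p)"
    "0 \<le> t + int q * w" "t + int q * w < int p * int q"
  shows "hits g t x"
proof -
  have p0: "int p > 0" using p_ge_2 by simp
  have "0 \<le> x" using assms(1,4) p0 by (metis zero_le_mult_iff not_less)
  moreover have "x < int q" using assms(1,5) p0 by (metis mult_less_cancel_left_pos)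
  moreover have "[int p * x = t] (mod int q)" using assms(1) by (simp add: cong_def)
  moreover have "[int g * x = t] (mod int p)"
    using cong_trans[OF cong_scalar_left[OF assms(2)] assms(3)] .
  ultimately show ?thesis unfolding hits_def by blast
qed

lemma residues_first:
  "\<exists>t x. 0 \<le> t \<and> t < int p * int p \<and> hits g t x \<and> [x = r] (mod int p)"
proof -
  obtain w t x where w: "0 \<le> w" "w < 0 + int p" and t: "0 \<le> t" "t < 0 + int p * int p"
    and x: "int p * x = t + int q * w" "[x = r] (mod int p)" "[int g * r = t] (mod int p)"
    using residues_in_square_window[of 0 0 r g] by blast
  have "int q * w \<le> int q * (int p - 1)" using w by (intro mult_left_mono) auto
  then have "t + int q * w < int p * int q" using t q_gt_int by (simp add: algebra_simps)
  moreover have "0 \<le> t + int q * w" using t w by simp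
  ultimately show ?thesis using hits_square_window[OF x] t x(2) by auto
qed

lemma residues_last:
  "\<exists>t x. int p * int q - int p * int p \<le> t \<and> t < int p * int q \<and> hits g t x \<and> [x = r] (mod int p)"
proof -
  obtain w t x where w: "1 - int p \<le> w" "w < 1 - int p + int p"
    and t: "int p * int q - int p * int p \<le> t" "t < int p * int q - int p * int p + int p * int p"
    and x: "int p * x = t + int q * w" "[x = r] (mod int p)" "[int g * r = t] (mod int p)"
    using residues_in_square_window[of "1 - int p" "int p * int q - int p * int p" r g] by blast
  have "int q * w \<ge> int q * (1 - int p)" using w by (intro mult_left_mono) auto
  then have "0 \<le> t + int q * w" using t q_gt_int by (simp add: algebra_simps)
  moreover have "int q * w \<le> 0" using w by (simp add: mult_le_0_iff)
  ultimately show ?thesis using hits_square_window[OF x] t x(2) by auto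
qed

lemma no_self_cover_late:
  assumes "g \<in> users p" "0 < d"
  shows "\<exists>x. 0 \<le> x \<and> x < int q \<and> [x = r] (mod int p) \<and>
    (\<forall>t y. 0 \<le> t \<and> t < int (p * q) \<and> hits g t x \<and> t \<ge> d \<longrightarrow> \<not> hits g (t - d) y)"
proof (cases "d < int p * int p")
  case True
  then show ?thesis using small_shift[OF assms(1), of "- d" r] assms(2) by auto
next
  case False
  obtain u x where u: "0 \<le> u" "u < int p * int p" "hits g u x" "[x = r] (mod int p)"
    using residues_first by blast
  have "int p * int p \<le> int p * int q" using q_gt_int p_le_square by (intro mult_left_mono) linarith+
  then have "t = u" if "0 \<le> t" "t < int (p * q)" "hits g t x" for t
    using hits_unique[OF that(3) u(3)] that u by simp
  then show ?thesis using u False unfolding hits_def by (intro exI[of _ x]) auto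
qed

lemma no_self_cover_early:
  assumes "g \<in> users p" "0 < d"
  shows "\<exists>x. 0 \<le> x \<and> x < int q \<and> [x = r] (mod int p) \<and>
    (\<forall>t y. 0 \<le> t \<and> t < int (p * q) \<and> hits g t x \<and> t + d < int (p * q) \<longrightarrow> \<not> hits g (t + d) y)"
proof (cases "d < int p * int p")
  case True
  then show ?thesis using small_shift[OF assms(1), of "d" r] assms(2) by auto
next
  case False
  obtain u x where u: "int p * int q - int p * int p \<le> u" "u < int p * int q" "hits g u x" "[x = r] (mod int p)"
    using residues_last by blast
  have "int p * int p \<le> int p * int q" using q_gt_int p_le_square by (intro mult_left_mono) linarith+
  then have "t = u" if "0 \<le> t" "t < int (p * q)" "hits g t x" for t
    using hits_unique[OF that(3) u(3)] that u by simp
  then show ?thesis using u False unfolding hits_def by (intro exI[of _ x]) auto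
qed

end

section \<open>Periods and sessions\<close>

lemma period_first_bounds:
  assumes "L > 0" "s \<le> t"
  shows "s \<le> period_first L s t" "period_first L s t \<le> t" "t < period_first L s t + L"
    "L dvd period_first L s t - s"
proof -
  have "t - s = (t - s) div L * L + (t - s) mod L" "(t - s) mod L < L" using assms by auto
  then show "period_first L s t \<le> t" "t < period_first L s t + L"
    using assms(2) unfolding period_first_def by linarith+
qed (simp_all add: period_first_def)

lemma period_first_of_dvd:
  assumes "s \<le> t" "L dvd t - s"
  shows "period_first L s t = t"
  using assms by (simp add: period_first_def)

lemma period_first_Suc:
  assumes "s \<le> t" "\<not> L dvd Suc t - s"
  shows "period_first L s (Suc t) = period_first L s t"
  using assms by (auto simp: period_first_def Suc_diff_le div_Suc dvd_eq_mod_eq_0)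

lemma period_last_before_multiple:
  assumes "L > 0" "s \<le> t" "L dvd Suc t - s"
  shows "period_last L s t = t"
proof -
  obtain k where k: "Suc t - s = L * k" using assms(3) by blast
  with assms(2) have "k > 0" by (intro Nat.gr0I) simp
  then obtain j where "k = Suc j" using gr0_implies_Suc by blast
  then have j: "t - s = L * j + (L - 1)" using k assms(1,2) by (simp add: Suc_diff_le)
  then have "(t - s) div L = j" using assms(1) by (intro div_nat_eqI) auto
  then show ?thesis using j assms(1,2) by (simp add: period_last_def period_first_def mult.commute)
qed

lemma active_since_le: "active_since act g s v \<Longrightarrow> s \<le> u \<Longrightarrow> u \<le> v \<Longrightarrow> active_since act g s u"
  by (auto simp: active_since_def)

lemma active_sinceD:
  assumes "active_since act g s t"
  shows "becomes_active act g s" "s \<le> t" "act g t"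
  using assms by (auto simp: active_since_def)

lemma active_since_self: "active_since act g s s \<longleftrightarrow> becomes_active act g s"
  by (auto simp: active_since_def becomes_active_def)

lemma active_since_ex: "act g t \<Longrightarrow> \<exists>s. active_since act g s t"
proof (induction t)
  case 0
  then have "active_since act g 0 0" by (simp add: active_since_def becomes_active_def)
  then show ?case ..
next
  case (Suc t)
  show ?case
  proof (cases "act g t")
    case True
    then obtain s where "active_since act g s t" using Suc.IH by blast
    then have "active_since act g s (Suc t)" using Suc.prems
      by (auto simp: active_since_def le_Suc_eq)
    then show ?thesis by blast
  next
    case False
    then have "becomes_active act g (Suc t)" using Suc.prems by (simp add: becomes_active_def)
    then show ?thesis using active_since_self by blast
  qed
qed

lemma active_since_unique:
  assumes "active_since act g s t" "active_since act g s' t"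
  shows "s = s'"
proof -
  have False if "s < s'" "active_since act g s t" "active_since act g s' t" for s s'
  proof -
    have "s' - 1 \<in> {s..t}" using that by (auto simp: active_since_def)
    then have "act g (s' - 1)" using that(2) unfolding active_since_def by blast
    then show False using that(1,3) by (auto simp: active_since_def becomes_active_def)
  qed
  then show ?thesis using assms by (metis linorder_neqE_nat)
qed

lemma active_since_end:
  assumes "active_since act g s u" "u \<le> v" "\<not> active_since act g s v"
  shows "\<exists>e. u \<le> e \<and> e < v \<and> active_since act g s e \<and> \<not> act g (Suc e)"
  using assms(2,3)
proof (induction v)
  case 0
  then show ?case using assms(1) by simp
next
  case (Suc v)
  show ?case
  proof (cases "u = Suc v")
    case True
    then show ?thesis using Suc.prems assms(1) by simp
  next
    case False
    then have uv: "u \<le> v" using Suc.prems by simp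
    show ?thesis
    proof (cases "active_since act g s v")
      case True
      then have "\<not> act g (Suc v)" using Suc.prems by (auto simp: active_since_def le_Suc_eq)
      then show ?thesis using True uv by auto
    next
      case False
      then show ?thesis using Suc.IH uv by (meson less_SucI)
    qed
  qed
qed

lemma session_unique:
  assumes act: "partial_activity L U act" "g \<in> U"
    and s: "active_since act g s u" "active_since act g s' u'"
    and near: "u \<le> u' + L" "u' \<le> u + L"
  shows "s = s'"
proof -
  have False if a: "s < s'" "active_since act g s u" "active_since act g s' u'" "u' \<le> u + L" for s s' u u'
  proof -
    have s': "active_since act g s' s'" and "s' \<le> u'"
      using a(3) by (auto simp: active_since_def)
    then have n: "\<not> active_since act g s s'" using active_since_unique a(1) by blast
    then have "u \<le> s'" using active_since_le a(1,2) by (metis less_imp_le nat_le_linear)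
    then obtain e where e: "u \<le> e" "e < s'" "active_since act g s e" "\<not> act g (Suc e)"
      using active_since_end[OF a(2) _ n] by blast
    then have "\<forall>v\<in>{Suc e..<Suc e + L}. \<not> act g v"
      using act active_sinceD(3) unfolding partial_activity_def by blast
    moreover have "act g s'" using s' active_sinceD(3) by blast
    ultimately have "s' \<notin> {Suc e..<Suc e + L}" by blast
    then show False using e \<open>s' \<le> u'\<close> a(4) by simp
  qed
  then show ?thesis using s near by (metis linorder_neqE_nat)
qed

section \<open>Matching and the receiver state\<close>

locale user_activity = crt_parameters +
  fixes act :: "nat \<Rightarrow> nat \<Rightarrow> bool"
  assumes partial: "partial_activity (p * q) (users p) act"
    and few_active: "2 * card {g \<in> users p. \<exists>u\<in>{t..<t + p * q}. act g u} \<le> p + 1"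
begin

lemma period_pos: "p * q > 0"
  using p_ge_2 q_gt by simp

lemma finite_users [simp]: "finite (users p)"
  by (simp add: users_def)

lemma hits_cong: "[t = u] (mod int (p * q)) \<Longrightarrow> hits g t x \<longleftrightarrow> hits g u x"
  unfolding hits_def using cong_modulus_mult[of t u "int p" "int q"] 
    cong_modulus_mult[of t u "int q" "int p"]
  by (auto simp: mult.commute intro: cong_trans cong_sym)

lemma transmits_iff:
  "transmits p q act g t \<longleftrightarrow> (\<exists>s. active_since act g s t \<and> (\<exists>x. hits g (int t - int s) x))"
proof -
  have "crt_seq p q g ((t - s) mod (p * q)) = 1 \<longleftrightarrow> (\<exists>x. hits g (int t - int s) x)"
    if "active_since act g s t" for s
  proof -
    have "int ((t - s) mod (p * q)) = (int t - int s) mod int (p * q)"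
      using active_sinceD(2)[OF that] by (simp add: of_nat_mod of_nat_diff)
    then have "[int ((t - s) mod (p * q)) = int t - int s] (mod int (p * q))"
      by (simp only: cong_def mod_mod_trivial)
    then show ?thesis using crt_seq_eq_1_iff hits_cong by simp
  qed
  then show ?thesis unfolding transmits_def by blast
qed

abbreviation "matches \<equiv> matched p q (channel_activity p q act)"

lemma matches_iff:
  "matches g t0 \<longleftrightarrow> (\<forall>t<p * q. crt_seq p q g t = 1 \<longrightarrow> (\<exists>h\<in>users p. transmits p q act h (t0 + t)))"
proof -
  have "(channel_activity p q act t = Single \<or> channel_activity p q act t = Collision)
      \<longleftrightarrow> (\<exists>h\<in>users p. transmits p q act h t)" for t
  proof -
    have "(channel_activity p q act t = Single \<or> channel_activity p q act t = Collision)
      \<longleftrightarrow> card {h \<in> users p. transmits p q act h t} \<noteq> 0"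
      by (auto simp: channel_activity_def Let_def)
    then show ?thesis by (auto simp: card_eq_0_iff)
  qed
  then show ?thesis unfolding matched_def by blast
qed

lemma matches_full_period:
  assumes "g \<in> users p" "active_since act g s (t0 + (p * q - 1))" "s \<le> t0" "p * q dvd t0 - s"
  shows "matches g t0"
proof -
  have "transmits p q act g (t0 + t)" if "t < p * q" "crt_seq p q g t = 1" for t
  proof -
    have "active_since act g s (t0 + t)" using assms(2,3) that(1) by (auto elim!: active_since_le)
    moreover have "(t0 + t - s) mod (p * q) = t"
    proof -
      have "t0 + t - s = (t0 - s) + t" using assms(3) by simp
      then show ?thesis using assms(4) that(1) by (simp add: mod_add_left_eq[symmetric] del: mod_add_left_eq)
    qed
    ultimately show ?thesis using that(2) unfolding transmits_def by metis
  qed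
  then show ?thesis using assms(1) unfolding matches_iff by blast
qed

definition others :: "nat \<Rightarrow> nat \<Rightarrow> nat set" where
  "others g t0 = {h \<in> users p. \<exists>u\<in>{t0..<t0 + p * q}. act h u} - {g}"

definition covered :: "nat \<Rightarrow> nat \<Rightarrow> nat \<Rightarrow> int set" where
  "covered g t0 h = {x. \<exists>t<p * q. hits g (int t) x \<and> transmits p q act h (t0 + t)}"

lemma session_in_window:
  assumes "h \<in> users p" "active_since act h s u" "u \<in> {t0..<t0 + p * q}"
    "t < p * q" "transmits p q act h (t0 + t)"
  shows "active_since act h s (t0 + t)" "\<exists>y. hits h (int (t0 + t) - int s) y"
proof -
  obtain s' where s': "active_since act h s' (t0 + t)" "\<exists>y. hits h (int (t0 + t) - int s') y"
    using assms(5) unfolding transmits_iff by blast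
  moreover have "s = s'"
    using session_unique[OF partial assms(1,2) s'(1)] assms(3,4) by auto
  ultimately show "active_since act h s (t0 + t)" "\<exists>y. hits h (int (t0 + t) - int s) y" by auto
qed

lemma two_class_covered:
  assumes "g \<in> users p" "h \<in> others g t0"
  shows "two_class (covered g t0 h)"
proof -
  have h: "h \<in> users p" "g \<noteq> h" using assms(2) by (auto simp: others_def)
  obtain u s where u: "u \<in> {t0..<t0 + p * q}" "active_since act h s u"
    using assms(2) active_since_ex unfolding others_def by blast
  have "covered g t0 h \<subseteq> {x. \<exists>t. hits g t x \<and> (\<exists>y. hits h (t + (int t0 - int s)) y)}"
    using session_in_window(2)[OF h(1) u(2,1)] unfolding covered_def
    by (auto simp: algebra_simps)
  then show ?thesis using cross_two_class[OF assms(1) h] two_class_subset by blast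
qed

lemma matches_covered:
  assumes "matches g t0" "0 \<le> x" "x < int q"
  shows "x \<in> covered g t0 g \<or> (\<exists>h\<in>others g t0. x \<in> covered g t0 h)"
proof -
  obtain t where t: "t < p * q" "hits g (int t) x" using hits_exists assms(2,3) by blast
  then obtain h where h: "h \<in> users p" "transmits p q act h (t0 + t)"
    using assms(1) crt_seq_eq_1_iff unfolding matches_iff by blast
  then have "act h (t0 + t)" using active_sinceD(3) unfolding transmits_def by blast
  then have "h \<noteq> g \<Longrightarrow> h \<in> others g t0" using h t by (auto simp: others_def)
  then show ?thesis using h t unfolding covered_def by blast
qed

lemma matches_imp_active:
  assumes "g \<in> users p" "matches g t0"
  shows "\<exists>u\<in>{t0..<t0 + p * q}. act g u"
proof (rule ccontr)
  assume idle: "\<not> ?thesis"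
  have "2 * card (others g t0) \<le> 2 * card {h \<in> users p. \<exists>u\<in>{t0..<t0 + p * q}. act h u}"
    unfolding others_def by (simp add: card_mono)
  then have "card (others g t0) < p" using few_active[of t0] p_ge_2 by linarith
  moreover have "finite (others g t0)" by (simp add: others_def)
  ultimately obtain x where "0 \<le> x" "x < int q" "\<forall>h\<in>others g t0. x \<notin> covered g t0 h"
    using uncovered_below_square two_class_covered[OF assms(1)] by metis
  then have "x \<in> covered g t0 g" using matches_covered[OF assms(2)] by blast
  then show False using idle active_sinceD(3) unfolding covered_def transmits_def by fastforce
qed

lemma matches_covers_residue_class:
  assumes "g \<in> users p" "matches g t0"
  shows "\<exists>r. \<forall>x. 0 \<le> x \<and> x < int q \<and> [x = r] (mod int p) \<longrightarrow> x \<in> covered g t0 g"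
proof (rule ccontr)
  assume no: "\<not> ?thesis"
  let ?A = "{h \<in> users p. \<exists>u\<in>{t0..<t0 + p * q}. act h u}"
  have "g \<in> ?A" using matches_imp_active[OF assms] assms(1) by blast
  then have "card (others g t0) < card ?A"
    unfolding others_def by (intro psubset_card_mono) auto
  then have "2 * card (others g t0) < p" using few_active[of t0] by linarith
  moreover have "finite (others g t0)" by (simp add: others_def)
  moreover have "\<exists>x\<in>{x. 0 \<le> x \<and> x < int q \<and> x \<notin> covered g t0 g}. [x = r] (mod int p)" for r
    using no by blast
  ultimately obtain x where "0 \<le> x" "x < int q" "x \<notin> covered g t0 g"
      "\<forall>h\<in>others g t0. x \<notin> covered g t0 h"
    using uncovered_in_complete_residues[of "others g t0" "covered g t0"
        "{x. 0 \<le> x \<and> x < int q \<and> x \<notin> covered g t0 g}"] two_class_covered[OF assms(1)] by blast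
  then show False using matches_covered[OF assms(2)] by blast
qed

lemma matches_imp_session:
  assumes g: "g \<in> users p" and m: "matches g t0"
  shows "\<exists>s. active_since act g s t0 \<and>
    (p * q dvd t0 - s \<or> active_since act g s (period_last (p * q) s t0))"
proof -
  obtain u s where u: "u \<in> {t0..<t0 + p * q}" "active_since act g s u"
    using matches_imp_active[OF assms] active_since_ex by blast
  obtain r where r: "\<And>x. 0 \<le> x \<Longrightarrow> x < int q \<Longrightarrow> [x = r] (mod int p) \<Longrightarrow> x \<in> covered g t0 g"
    using matches_covers_residue_class[OF assms] by blast
  have cov: "\<exists>t<p * q. hits g (int t) x \<and> active_since act g s (t0 + t)
      \<and> (\<exists>y. hits g (int (t0 + t) - int s) y)" if "x \<in> covered g t0 g" for x
    using that session_in_window[OF g u(2,1)] unfolding covered_def by blast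
  have st: "s \<le> t0"
  proof (rule ccontr)
    assume "\<not> s \<le> t0"
    then obtain x where x: "0 \<le> x" "x < int q" "[x = r] (mod int p)"
      and no: "\<And>t y. 0 \<le> t \<Longrightarrow> t < int (p * q) \<Longrightarrow> hits g t x \<Longrightarrow> t \<ge> int s - int t0
        \<Longrightarrow> \<not> hits g (t - (int s - int t0)) y"
      using no_self_cover_late[OF g, of "int s - int t0" r] by auto
    obtain t y where "t < p * q" "hits g (int t) x" "active_since act g s (t0 + t)"
      "hits g (int (t0 + t) - int s) y" using cov[OF r[OF x]] by blast
    then show False using no[of "int t" y] active_sinceD(2) by (fastforce simp: algebra_simps)
  qed
  then have since: "active_since act g s t0" using u active_since_le by simp
  have "active_since act g s (period_last (p * q) s t0)" if nd: "\<not> p * q dvd t0 - s"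
  proof (rule ccontr)
    assume cut: "\<not> ?thesis"
    define d where "d = (t0 - s) mod (p * q)"
    have d: "d > 0" using nd by (simp add: d_def dvd_eq_mod_eq_0)
    have last: "period_last (p * q) s t0 + d = t0 + (p * q - 1)"
      using st div_mult_mod_eq[of "t0 - s" "p * q"] unfolding period_last_def period_first_def d_def by linarith
    obtain x where x: "0 \<le> x" "x < int q" "[x = r] (mod int p)"
      and no: "\<And>t y. 0 \<le> t \<Longrightarrow> t < int (p * q) \<Longrightarrow> hits g t x \<Longrightarrow> t + int d < int (p * q)
        \<Longrightarrow> \<not> hits g (t + int d) y"
      using no_self_cover_early[OF g, of "int d" r] d by auto
    obtain t y where t: "t < p * q" "hits g (int t) x" "active_since act g s (t0 + t)"
      "hits g (int (t0 + t) - int s) y" using cov[OF r[OF x]] by blast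
    have "\<not> period_last (p * q) s t0 \<le> t0 + t"
      using cut active_since_le[OF t(3)] st period_first_bounds(1)[OF period_pos st]
      by (auto simp: period_last_def)
    then have "t + d < p * q" using last by linarith
    moreover have "hits g (int t + int d) y"
    proof -
      have "int (t0 + t) - int s = int (t0 - s) + int t" using st by simp
      moreover have "[int (t0 - s) = int d] (mod int (p * q))"
        unfolding d_def by (simp only: cong_def of_nat_mod mod_mod_trivial)
      ultimately have "[int (t0 + t) - int s = int t + int d] (mod int (p * q))"
        by (metis add.commute cong_add_rcancel)
      then show ?thesis using t(4) hits_cong by blast
    qed
    ultimately show False using no[of "int t" y] t(1,2) by (metis of_nat_0_le_iff of_nat_add of_nat_less_iff)
  qed
  then show ?thesis using since by blast
qed

abbreviation "rx \<equiv> receiver_state p q (channel_activity p q act)"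

lemma rx_Suc:
  assumes g: "g \<in> users p"
  shows "\<not> active (rx n) g \<Longrightarrow> active (rx (Suc n)) g \<longleftrightarrow> matches g n"
    and "\<not> active (rx n) g \<Longrightarrow> matches g n \<Longrightarrow> start (rx (Suc n)) g = n"
    and "active (rx n) g \<Longrightarrow>
      active (rx (Suc n)) g \<longleftrightarrow> \<not> ([n = start (rx n) g] (mod p * q) \<and> \<not> matches g n)"
    and "active (rx n) g \<Longrightarrow> active (rx (Suc n)) g \<Longrightarrow> start (rx (Suc n)) g = start (rx n) g"
  using g by (auto simp: receiver_step_def detects_start_def detects_end_def)

definition tracked :: "nat \<Rightarrow> nat \<Rightarrow> bool" where
  "tracked g t \<longleftrightarrow>
    (\<forall>s\<le>t. active_since act g s (period_last (p * q) s t) \<longrightarrow> active (rx (Suc t)) g) \<and>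
    (active (rx (Suc t)) g \<longrightarrow> start (rx (Suc t)) g \<le> t \<and>
      active_since act g (start (rx (Suc t)) g) (period_first (p * q) (start (rx (Suc t)) g) t))"

lemma cong_iff_dvd_diff_le: "s \<le> n \<Longrightarrow> [n = s] (mod L) \<longleftrightarrow> L dvd n - s" for n s L :: nat
  by (simp add: cong_altdef_nat)

lemma complete_period_matches:
  assumes "g \<in> users p" "s \<le> n" "active_since act g s (period_last (p * q) s n)" "p * q dvd n - s"
  shows "matches g n"
  using matches_full_period[OF assms(1) _ assms(2,4)] assms(3) period_first_of_dvd[OF assms(2,4)]
  by (simp add: period_last_def)

lemma complete_period_before:
  assumes s: "s \<le> n" "active_since act g s (period_last (p * q) s (Suc n))"
  shows "active_since act g s (period_last (p * q) s n)"
proof (cases "p * q dvd Suc n - s")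
  case True
  then have "period_last (p * q) s n = n" "period_last (p * q) s (Suc n) \<ge> Suc n"
    using period_last_before_multiple[OF period_pos s(1)] s(1)
    by (auto simp: period_last_def period_first_of_dvd)
  then show ?thesis using s active_since_le by simp
next
  case False
  then show ?thesis using s period_first_Suc by (simp add: period_last_def)
qed

lemma tracked_of_idle:
  assumes g: "g \<in> users p" and idle: "\<not> active (rx n) g"
    and old: "\<And>s. s < n \<Longrightarrow> \<not> active_since act g s (period_last (p * q) s (n - 1))"
  shows "tracked g n"
proof (cases "matches g n")
  case True
  obtain s where s: "active_since act g s n" 
    "p * q dvd n - s \<or> active_since act g s (period_last (p * q) s n)"
    using matches_imp_session[OF g True] by blast
  have "s = n"
  proof (rule ccontr)
    assume "s \<noteq> n"
    then have sn: "s < n" using active_sinceD(2)[OF s(1)] by simp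
    then obtain m where m: "n = Suc m" "s \<le> m" using less_iff_Suc_add by auto
    have "active_since act g s (period_last (p * q) s m)"
    proof (cases "p * q dvd n - s")
      case True
      then have "period_last (p * q) s m = m" using period_last_before_multiple[OF period_pos] m by simp
      then show ?thesis using active_since_le[OF s(1) m(2)] m(1) by simp
    next
      case False
      then show ?thesis using complete_period_before m s(2) by blast
    qed
    then show False using old[OF sn] m by simp
  qed
  then show ?thesis
    using s(1) rx_Suc(1,2)[OF g idle] True unfolding tracked_def by (simp add: period_first_of_dvd)
next
  case False
  then have "\<not> active (rx (Suc n)) g" using rx_Suc(1)[OF g idle] by simp
  moreover have "\<not> active_since act g s (period_last (p * q) s n)" if "s \<le> n" for s
  proof
    assume a: "active_since act g s (period_last (p * q) s n)"
    show False
    proof (cases "s = n")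
      case True
      then show False using complete_period_matches[OF g that a] False by simp
    next
      case neq: False
      then have "s < n" using that by simp
      then obtain m where "n = Suc m" "s \<le> m" using less_iff_Suc_add by auto
      then show False using complete_period_before a old[of s] by simp
    qed
  qed
  ultimately show ?thesis unfolding tracked_def by blast
qed

lemma tracked_of_active:
  assumes g: "g \<in> users p" and on: "active (rx (Suc n)) g" and IH: "tracked g n"
  shows "tracked g (Suc n)"
proof -
  define s0 where "s0 = start (rx (Suc n)) g"
  have s0: "s0 \<le> n" "active_since act g s0 (period_first (p * q) s0 n)"
    using IH on unfolding tracked_def s0_def by auto
  have near: "period_first (p * q) s0 n \<le> n" "n < period_first (p * q) s0 n + p * q"
    using period_first_bounds[OF period_pos s0(1)] by auto
  have same: "s = s0" if "active_since act g s (Suc n)" for s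
    using session_unique[OF partial g that s0(2)] near by simp
  have dvd: "[Suc n = s0] (mod p * q) \<longleftrightarrow> p * q dvd Suc n - s0"
    using cong_iff_dvd_diff_le s0(1) by simp
  show ?thesis
  proof (cases "active (rx (Suc (Suc n))) g")
    case True
    then have st: "start (rx (Suc (Suc n))) g = s0" using rx_Suc(4)[OF g on] s0_def by simp
    have "active_since act g s0 (period_first (p * q) s0 (Suc n))"
    proof (cases "p * q dvd Suc n - s0")
      case d: True
      then have "matches g (Suc n)" using rx_Suc(3)[OF g on] True dvd s0_def by blast
      then obtain s where "active_since act g s (Suc n)" using matches_imp_session[OF g] by blast
      then show ?thesis using same d s0(1) period_first_of_dvd by auto
    next
      case False
      then show ?thesis using s0 period_first_Suc by simp
    qed
    then show ?thesis using True st s0(1) unfolding tracked_def by simp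
  next
    case False
    then have f: "p * q dvd Suc n - s0" "\<not> matches g (Suc n)"
      using rx_Suc(3)[OF g on] dvd s0_def by auto
    have "\<not> active_since act g s (period_last (p * q) s (Suc n))" if "s \<le> Suc n" for s
    proof
      assume a: "active_since act g s (period_last (p * q) s (Suc n))"
      have "Suc n \<le> period_last (p * q) s (Suc n)"
        using period_first_bounds(3)[OF period_pos that] unfolding period_last_def by linarith
      then have "s = s0" using same active_since_le[OF a that] by blast
      then show False using complete_period_matches[OF g that a] f by simp
    qed
    then show ?thesis using False unfolding tracked_def by blast
  qed
qed

lemma tracked: "g \<in> users p \<Longrightarrow> tracked g n"
proof (induction n)
  case 0
  then show ?case by (intro tracked_of_idle) (auto simp: initial_receiver_def)
next
  case (Suc n)
  show ?case
  proof (cases "active (rx (Suc n)) g")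
    case True
    then show ?thesis using tracked_of_active Suc by blast
  next
    case False
    have "\<not> active_since act g s (period_last (p * q) s n)" if "s \<le> n" for s
      using Suc False that unfolding tracked_def by blast
    then show ?thesis using tracked_of_idle[OF Suc.prems False] by auto
  qed
qed

lemma rx_active:
  assumes "g \<in> users p" "active (rx (Suc t)) g"
  shows "start (rx (Suc t)) g \<le> t"
    "active_since act g (start (rx (Suc t)) g) (period_first (p * q) (start (rx (Suc t)) g) t)"
  using tracked[OF assms(1), of t] assms(2) unfolding tracked_def by auto

lemma rx_start_eq:
  assumes "g \<in> users p" "active (rx (Suc t)) g" "active_since act g s u" "t \<le> u" "u \<le> Suc t"
  shows "start (rx (Suc t)) g = s"
  using session_unique[OF partial assms(1) rx_active(2)[OF assms(1,2)] assms(3)]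
    period_first_bounds[OF period_pos rx_active(1)[OF assms(1,2)]] assms(4,5) by simp

lemma rx_complete_period:
  assumes g: "g \<in> users p" and s: "s \<le> t" "active_since act g s (period_last (p * q) s t)"
  shows "active (rx (Suc t)) g" "start (rx (Suc t)) g = s"
proof -
  show on: "active (rx (Suc t)) g" using tracked[OF g, of t] s unfolding tracked_def by blast
  have "t \<le> period_last (p * q) s t"
    using period_first_bounds(3)[OF period_pos s(1)] unfolding period_last_def by linarith
  then have "active_since act g s t" using active_since_le s by blast
  then show "start (rx (Suc t)) g = s" using rx_start_eq[OF g on] by simp
qed

lemma rx_becomes_active_iff:
  assumes g: "g \<in> users p"
  shows "becomes_active act g t \<longleftrightarrow> \<not> active (rx t) g \<and> active (rx (Suc t)) g"
proof
  assume b: "becomes_active act g t"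
  then have "\<forall>u\<in>{t..<t + p * q}. act g u" using partial g unfolding partial_activity_def by blast
  moreover have "u < t + p * q" if "u \<le> t + (p * q - 1)" for u
    using that period_pos by linarith
  ultimately have "active_since act g t (t + (p * q - 1))"
    using b unfolding active_since_def by simp
  then have "active (rx (Suc t)) g"
    using rx_complete_period(1)[OF g, of t t] by (simp add: period_last_def period_first_def)
  moreover have "\<not> active (rx t) g"
  proof
    assume on: "active (rx t) g"
    then have "t \<noteq> 0" by (auto simp: initial_receiver_def intro: Nat.gr0I)
    then obtain n where n: "t = Suc n" using not0_implies_Suc by blast
    have "start (rx (Suc n)) g = Suc n"
      using rx_start_eq[OF g on[unfolded n], of t t] b n by (simp add: active_since_self)
    then show False using rx_active(1)[OF g on[unfolded n]] by simp
  qed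
  ultimately show "\<not> active (rx t) g \<and> active (rx (Suc t)) g" by blast
next
  assume a: "\<not> active (rx t) g \<and> active (rx (Suc t)) g"
  then have "start (rx (Suc t)) g = t" using rx_Suc(1,2)[OF g] by blast
  then show "becomes_active act g t" using rx_active(2)[OF g] a active_sinceD(1) by metis
qed

lemma whole_periods_extend:
  assumes w: "whole_periods (p * q) act g" and s: "s \<le> t"
    and a: "active_since act g s (period_first (p * q) s t)"
  shows "active_since act g s (period_last (p * q) s t)"
proof (rule ccontr)
  assume "\<not> ?thesis"
  then obtain e where e: "period_first (p * q) s t \<le> e" "e < period_last (p * q) s t"
      "active_since act g s e" "\<not> act g (Suc e)"
    using active_since_end[OF a, of "period_last (p * q) s t"] by (auto simp: period_last_def)
  then have "p * q dvd Suc e - s" using w unfolding whole_periods_def by blast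
  moreover have "p * q dvd period_first (p * q) s t - s" "s \<le> period_first (p * q) s t"
    using period_first_bounds[OF period_pos s] by auto
  moreover from this have "(Suc e - s) - (period_first (p * q) s t - s) = Suc e - period_first (p * q) s t"
    by linarith
  ultimately have "p * q dvd Suc e - period_first (p * q) s t" by (metis dvd_diff_nat)
  then have "p * q \<le> Suc e - period_first (p * q) s t" using e(1) by (intro dvd_imp_le) auto
  then show False using e(2) period_pos unfolding period_last_def by linarith
qed

lemma identifies:
  assumes g: "g \<in> users p"
  shows "identifies_user (p * q) act rx g t"
proof -
  have last: "t \<le> period_last (p * q) s t" if "s \<le> t" for s
    using period_first_bounds(3)[OF period_pos that] unfolding period_last_def by linarith
  have "(active (rx (Suc t)) g \<longleftrightarrow> act g t) \<and> (act g t \<longrightarrow> active_since act g (start (rx (Suc t)) g) t)"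
    if w: "whole_periods (p * q) act g"
  proof -
    have "active (rx (Suc t)) g \<and> active_since act g (start (rx (Suc t)) g) t" if on: "act g t"
    proof -
      obtain s where s: "active_since act g s t" using active_since_ex[of act g, OF on] by blast
      have "s \<le> t" using active_sinceD(2)[OF s] .
      moreover have "active_since act g s (period_first (p * q) s t)"
        using active_since_le[OF s] period_first_bounds[OF period_pos \<open>s \<le> t\<close>] by blast
      ultimately have "active_since act g s (period_last (p * q) s t)"
        using whole_periods_extend[OF w] by blast
      then show ?thesis using rx_complete_period[OF g \<open>s \<le> t\<close>] s by simp
    qed
    moreover have "act g t" if on: "active (rx (Suc t)) g"
      using whole_periods_extend[OF w rx_active[OF g on]] last[OF rx_active(1)[OF g on]]
        rx_active(1)[OF g on] active_since_le active_sinceD(3) by blast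
    ultimately show ?thesis by blast
  qed
  then show ?thesis
    unfolding identifies_user_def
    using rx_becomes_active_iff[OF g] rx_complete_period[OF g] rx_active[OF g] by blast
qed

end

theorem theorem9:
  fixes p q :: nat and act :: "nat \<Rightarrow> nat \<Rightarrow> bool"
  assumes "prime p" and "q > 2 * p\<^sup>2" and "coprime p q"
    and "partial_activity (p * q) (users p) act"
    and "\<forall>t. real (card {g \<in> users p. \<exists>u\<in>{t..<t + p * q}. act g u}) \<le> (real p + 1) / 2"
  shows "\<forall>g\<in>users p. \<forall>t. identifies_user (p * q) act
           (receiver_state p q (channel_activity p q act)) g t"
proof -
  have "2 * card {g \<in> users p. \<exists>u\<in>{t..<t + p * q}. act g u} \<le> p + 1" for t
  proof -
    have "real (2 * card {g \<in> users p. \<exists>u\<in>{t..<t + p * q}. act g u}) \<le> real (p + 1)"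
      using assms(5)[rule_format, of t] by (simp add: field_simps)
    then show ?thesis by (simp only: of_nat_le_iff)
  qed
  then interpret user_activity p q act
    using assms by unfold_locales
  show ?thesis using identifies by blast
qed

end
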